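(* Let $U=[0,1]^2$ and let $S\subset U$ be a finite set of $n$ points with $(0,0)\in S$. Order the points of $S$ as $s_1,\dots,s_n$ so that $x(s_j)+y(s_j)\le x(s_i)+y(s_i)$ whenever $i<j$ (ties broken arbitrarily). Then the rectangles $r_1,\dots,r_n$ chosen by the algorithm TilePacking (defined below) are pairwise interior-disjoint, $r_i$ has lower left corner $s_i$, and their total area satisfies $\sum_{i=1}^n \mathrm{area}(r_i)\ge 0.09121$. Consequently, the rectangles chosen by the algorithm GreedyPacking (defined below) also have total area at least $0.09121$.
   Context: For points $p=(x_p,y_p)$, $q=(x_q,y_q)$ write $p\preceq q$ ($q$ dominates $p$) if $x_p\le x_q$ and $y_p\le y_q$. With the ordering $s_1,\dots,s_n$ of $S$ as in the claim, define the tiles $t_i=\{p\in[0,1]^2: s_i\preceq p \text{ and } s_j\not\preceq p \text{ for all } j<i\}$ for $i=1,\dots,n$; these are staircase polygons with lower left corner $s_i$ that tile $U$. TilePacking: for each $i$ independently, choose an axis-aligned rectangle $r_i\subseteq t_i$ of maximum area (such a rectangle has lower left corner $s_i$). GreedyPacking: for $i=1,\dots,n$ in this order, choose an axis-aligned rectangle $r_i\subseteq[0,1]^2$ of maximum area whose lower left corner is $s_i$ and which is interior-disjoint from every $r_j$, $j<i$.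
   Formalization: Rectangles are closed and r_i is chosen in the closure of the tile t_i (t_i itself may contain no rectangle of maximum area); for points s_i with a coordinate equal to 1, whose tile has empty interior, the zero-area r_i is required to have lower left corner s_i. *)

theory Defs
  imports "HOL-Analysis.Analysis"
begin

text \<open>Points of the plane are pairs of reals. The library order on pairs is componentwise,
  so \<open>p \<le> q\<close> is the dominance relation (\<open>q\<close> dominates \<open>p\<close>). Rectangles are closed.\<close>

definition unit_square :: "(real \<times> real) set" where
  "unit_square = cbox (0, 0) (1, 1)"

definition rect_with_lower_left :: "real \<times> real \<Rightarrow> (real \<times> real) set \<Rightarrow> bool" where
  "rect_with_lower_left p R \<longleftrightarrow> (\<exists>q. p \<le> q \<and> R = cbox p q)"

definition axis_rect :: "(real \<times> real) set \<Rightarrow> bool" where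
  "axis_rect R \<longleftrightarrow> (\<exists>p. rect_with_lower_left p R)"

abbreviation area :: "(real \<times> real) set \<Rightarrow> real" where
  "area \<equiv> measure lborel"

definition interior_disjoint :: "(real \<times> real) set \<Rightarrow> (real \<times> real) set \<Rightarrow> bool" where
  "interior_disjoint A B \<longleftrightarrow> interior A \<inter> interior B = {}"

definition tile :: "(nat \<Rightarrow> real \<times> real) \<Rightarrow> nat \<Rightarrow> (real \<times> real) set" where
  "tile s i = {p \<in> unit_square. s i \<le> p \<and> (\<forall>j\<in>{1..<i}. \<not> s j \<le> p)}"

text \<open>The set \<^term>\<open>tile s i\<close> lacks part of its upper right boundary, so a closed rectangle of
  maximum area inside it need not exist; the rectangle is chosen in the closed staircase
  polygon \<^term>\<open>closure (tile s i)\<close>.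

  If \<^term>\<open>s i\<close> lies on the right or upper side of the unit square, the tile is a segment or a
  point: every rectangle in it has area 0, hence maximum area, wherever its lower left corner
  is. Only for such a tile does the last conjunct prescribe the corner; in all other cases the
  corner is forced by maximality.\<close>

definition tile_packing :: "(nat \<Rightarrow> real \<times> real) \<Rightarrow> nat \<Rightarrow> (nat \<Rightarrow> (real \<times> real) set) \<Rightarrow> bool" where
  "tile_packing s n r \<longleftrightarrow>
    (\<forall>i\<in>{1..n}.
      axis_rect (r i) \<and> r i \<subseteq> closure (tile s i) \<and>
      (\<forall>R. axis_rect R \<and> R \<subseteq> closure (tile s i) \<longrightarrow> area R \<le> area (r i)) \<and>
      (interior (tile s i) = {} \<longrightarrow> rect_with_lower_left (s i) (r i)))"

definition greedy_candidate ::
  "(nat \<Rightarrow> real \<times> real) \<Rightarrow> (nat \<Rightarrow> (real \<times> real) set) \<Rightarrow> nat \<Rightarrow> (real \<times> real) set \<Rightarrow> bool" where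
  "greedy_candidate s r i R \<longleftrightarrow>
    rect_with_lower_left (s i) R \<and> R \<subseteq> unit_square \<and> (\<forall>j\<in>{1..<i}. interior_disjoint R (r j))"

definition greedy_packing :: "(nat \<Rightarrow> real \<times> real) \<Rightarrow> nat \<Rightarrow> (nat \<Rightarrow> (real \<times> real) set) \<Rightarrow> bool" where
  "greedy_packing s n r \<longleftrightarrow>
    (\<forall>i\<in>{1..n}.
      greedy_candidate s r i (r i) \<and>
      (\<forall>R. greedy_candidate s r i R \<longrightarrow> area R \<le> area (r i)))"

end

theory Submission
  imports Defs
begin

text \<open>Let \<open>b\<close> be the side of the largest square with lower left corner \<open>s\<^sub>i\<close> in tile \<open>t\<^sub>i\<close>, let \<open>w\<close>
  and \<open>h\<close> be the lengths of the bottom and left side of \<open>t\<^sub>i\<close>, and let \<open>A\<close> bound the area of the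
  rectangles \<open>[s\<^sub>i, p]\<close> with \<open>p \<in> t\<^sub>i\<close>. The tile lies in the union of a horizontal arm of height \<open>b\<close>
  and a vertical arm of width \<open>b\<close>. In the horizontal arm, the part at relative height between \<open>v\<close>
  and \<open>3v/2\<close> has width at most \<open>A/v\<close>, hence area at most \<open>A/2\<close>. Eight such steps, starting from a
  strip of height \<open>(2/3)\<^sup>8 b\<close>, exhaust the arm. With the same bound for the vertical arm,
  \<open>area t\<^sub>i \<le> 8 A + (2/3)\<^sup>8 b (w + h)\<close>.

  Fix a vertical line and consider the tiles whose bottom side it meets. From bottom to top, the
  coordinate sum of their corners does not decrease, and since tiles are disjoint, \<open>x + 2y\<close> increases
  from each corner to the next by at least the side \<open>b\<close> of the lower one. So the sides \<open>b\<close> of these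
  tiles sum to at most 3, and integrating over all lines gives \<open>\<Sum> b w \<le> 3\<close>. By symmetry
  \<open>\<Sum> b h \<le> 3\<close>, so that \<open>1 \<le> 8 \<Sum> A + 6 (2/3)\<^sup>8\<close>, that is \<open>\<Sum> A > 0.0957\<close>.

  Both algorithms choose a rectangle at least as large as each \<open>[s\<^sub>i, p]\<close> with \<open>p \<in> t\<^sub>i\<close>.\<close>

section \<open>Boxes, Borel sets and reflection in the diagonal\<close>

lemma mem_cbox_iff:
  fixes p a b :: "real \<times> real"
  shows "p \<in> cbox a b \<longleftrightarrow> a \<le> p \<and> p \<le> b"
  by (simp add: interval_cbox[symmetric])

lemma area_cbox:
  fixes p q :: "real \<times> real"
  assumes "p \<le> q"
  shows "area (cbox p q) = (fst q - fst p) * (snd q - snd p)"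
  using assms content_Pair[of "fst p" "snd p" "fst q" "snd q"]
  by (simp add: less_eq_prod_def)

lemma borel_swap_image:
  fixes X :: "(real \<times> real) set"
  assumes "X \<in> sets borel"
  shows "prod.swap ` X \<in> sets borel"
proof -
  have "prod.swap ` X = prod.swap -` X \<inter> space borel" by force
  moreover have "prod.swap \<in> borel_measurable (borel :: (real \<times> real) measure)"
    by (intro borel_measurable_continuous_onI continuous_intros)
  ultimately show ?thesis using assms measurable_sets by metis
qed

lemma area_swap_image:
  assumes "X \<in> sets borel"
  shows "area (prod.swap ` X) = area X"
proof -
  have *: "distr lborel lborel prod.swap = (lborel :: (real \<times> real) measure)"
    using lborel_pair.distr_pair_swap[where ?'a = real and ?'b = real]
    by (simp add: lborel_prod case_prod_unfold comp_def flip: prod.swap_def)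
  have "measure lborel X = measure (distr lborel lborel prod.swap) X"
    by (simp add: *)
  also have "\<dots> = measure lborel (prod.swap -` X \<inter> space lborel)"
    using assms by (intro measure_distr)
      (auto intro!: borel_measurable_continuous_onI continuous_intros)
  also have "prod.swap -` X \<inter> space lborel = prod.swap ` X" by force
  finally show ?thesis ..
qed

lemma area_Times_cbox:
  fixes B :: "real set"
  assumes "B \<in> sets borel" "B \<subseteq> cbox 0 1" "0 \<le> h"
  shows "B \<times> cbox y (y + h) \<in> fmeasurable lborel"
    and "area (B \<times> cbox y (y + h)) = measure lborel B * h"
proof -
  have "bounded B" using assms(2) bounded_cbox bounded_subset by blast
  then have "emeasure lborel B < \<infinity>" by (rule emeasure_bounded_finite)
  then have B: "emeasure lborel B = ennreal (measure lborel B)"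
    by (intro emeasure_eq_ennreal_measure) simp
  have eq: "emeasure lborel (B \<times> cbox y (y + h)) = ennreal (measure lborel B * h)"
    using lborel.emeasure_pair_measure_Times[of B lborel "cbox y (y + h)"] assms B
    by (simp add: lborel_prod ennreal_mult)
  show "area (B \<times> cbox y (y + h)) = measure lborel B * h"
    using eq assms by (simp add: measure_def)
  have "B \<times> cbox y (y + h) \<in> sets (lborel \<Otimes>\<^sub>M lborel)" using assms by auto
  then show "B \<times> cbox y (y + h) \<in> fmeasurable lborel"
    unfolding lborel_prod using eq by (intro fmeasurableI) auto
qed

subsection \<open>Tiles\<close>

lemma mem_tile:
  "p \<in> tile s i \<longleftrightarrow> p \<in> unit_square \<and> s i \<le> p \<and> (\<forall>j\<in>{1..<i}. \<not> s j \<le> p)"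
  by (simp add: tile_def)

lemma mem_unit_square:
  "p \<in> unit_square \<longleftrightarrow> 0 \<le> fst p \<and> fst p \<le> 1 \<and> 0 \<le> snd p \<and> snd p \<le> 1"
  by (auto simp: unit_square_def mem_cbox_iff less_eq_prod_def)

lemma tile_down_closed:
  assumes "p \<in> tile s i" "s i \<le> q" "q \<le> p" "s i \<in> unit_square"
  shows "q \<in> tile s i"
  using assms by (force simp: mem_tile mem_unit_square less_eq_prod_def)

lemma cbox_subset_tile:
  assumes "p \<in> tile s i" "s i \<in> unit_square"
  shows "cbox (s i) p \<subseteq> tile s i"
  using tile_down_closed[OF assms(1) _ _ assms(2)] by (auto simp: mem_cbox_iff)

lemma tile_borel: "tile s i \<in> sets borel"
proof -
  have "tile s i = unit_square \<inter> {s i..} - (\<Union>j\<in>{1..<i}. {s j..})"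
    by (auto simp: tile_def)
  moreover have "closed {a..}" for a :: "real \<times> real"
    by (simp add: closed_eucl_atLeast)
  ultimately show ?thesis
    by (auto simp: unit_square_def intro!: sets.Diff sets.finite_UN borel_closed)
qed

lemma tile_swap: "tile (prod.swap \<circ> s) i = prod.swap ` tile s i"
proof -
  have "q \<in> tile (prod.swap \<circ> s) i \<longleftrightarrow> prod.swap q \<in> tile s i" for q
    by (auto simp: mem_tile mem_unit_square less_eq_prod_def)
  then show ?thesis by force
qed

text \<open>Not dominating \<open>s j\<close> survives a limit only in strict form: the open
  quadrant above \<open>s j\<close> misses the tile, hence also its closure.\<close>

lemma closure_tile:
  assumes "p \<in> closure (tile s i)"
  shows "p \<in> unit_square" "s i \<le> p"
    "j \<in> {1..<i} \<Longrightarrow> \<not> (fst (s j) < fst p \<and> snd (s j) < snd p)"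
proof -
  obtain f where f: "\<And>k. f k \<in> tile s i" "f \<longlonglongrightarrow> p"
    using assms closure_sequential by blast
  have "closure (tile s i) \<subseteq> unit_square \<inter> {s i..}"
    by (rule closure_minimal)
      (auto simp: mem_tile unit_square_def intro!: closed_Int closed_eucl_atLeast)
  then show "p \<in> unit_square" "s i \<le> p" using assms by auto
  assume j: "j \<in> {1..<i}"
  show "\<not> (fst (s j) < fst p \<and> snd (s j) < snd p)"
  proof
    assume "fst (s j) < fst p \<and> snd (s j) < snd p"
    then have "\<forall>\<^sub>F k in sequentially. fst (s j) < fst (f k)"
      "\<forall>\<^sub>F k in sequentially. snd (s j) < snd (f k)"
      using tendsto_fst[OF f(2)] tendsto_snd[OF f(2)] by (auto intro: order_tendstoD)
    then have "\<forall>\<^sub>F k in sequentially. s j \<le> f k"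
      by eventually_elim (simp add: less_eq_prod_def)
    then obtain k where "s j \<le> f k" by (auto simp: eventually_sequentially)
    with f(1)[of k] j show False by (auto simp: mem_tile)
  qed
qed

text \<open>Clip a sequence of tile points tending to \<open>q\<close> coordinatewise at
  \<open>x\<close>: it stays in the tile, which is closed downwards above \<open>s i\<close>, and
  tends to \<open>x\<close>.\<close>

lemma cbox_subset_closure_tile:
  assumes "q \<in> closure (tile s i)" "s i \<in> unit_square"
  shows "cbox (s i) q \<subseteq> closure (tile s i)"
proof
  fix x assume x: "x \<in> cbox (s i) q"
  obtain f where f: "\<And>k. f k \<in> tile s i" "f \<longlonglongrightarrow> q"
    using assms(1) closure_sequential by blast
  define g where "g k = (min (fst x) (fst (f k)), min (snd x) (snd (f k)))" for k
  have "g k \<in> tile s i" for k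
    using x f(1)[of k] assms(2)
    by (intro tile_down_closed[OF f(1)[of k]])
      (auto simp: g_def mem_tile mem_cbox_iff less_eq_prod_def)
  moreover have "g \<longlonglongrightarrow> (min (fst x) (fst q), min (snd x) (snd q))"
    unfolding g_def by (intro tendsto_intros f(2))
  moreover have "(min (fst x) (fst q), min (snd x) (snd q)) = x"
    using x by (auto simp: mem_cbox_iff less_eq_prod_def prod_eq_iff)
  ultimately show "x \<in> closure (tile s i)" by (auto simp: closure_sequential)
qed

lemma open_strict_below:
  fixes p :: "real \<times> real"
  assumes "open U" "p \<in> U"
  obtains q where "q \<in> U" "fst q < fst p" "snd q < snd p"
proof -
  have "(\<lambda>k. (fst p - 1 / Suc k, snd p - 1 / Suc k)) \<longlonglongrightarrow> (fst p - 0, snd p - 0)"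
    by (intro tendsto_intros LIMSEQ_Suc lim_1_over_n)
  then have "\<forall>\<^sub>F k in sequentially. (fst p - 1 / Suc k, snd p - 1 / Suc k) \<in> U"
    using assms by (auto intro: topological_tendstoD)
  then obtain k where "(fst p - 1 / Suc k, snd p - 1 / Suc k) \<in> U"
    by (auto simp: eventually_sequentially)
  then show ?thesis by (rule that) auto
qed

text \<open>An interior point of the tile forces the maximal area to be positive, so both sides of
  \<open>r\<close> are positive. Moving the lower left corner of \<open>r\<close> back to
  \<open>s i\<close> stays inside the closure and would strictly enlarge the area unless it already
  sits there.\<close>

lemma lower_left_of_max_rect:
  assumes si: "s i \<in> unit_square"
    and r: "axis_rect r" "r \<subseteq> closure (tile s i)"
    and max: "\<And>R. axis_rect R \<Longrightarrow> R \<subseteq> closure (tile s i) \<Longrightarrow> area R \<le> area r"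
    and int: "interior (tile s i) \<noteq> {}"
  shows "rect_with_lower_left (s i) r"
proof -
  have box: "axis_rect (cbox (s i) q) \<and> cbox (s i) q \<subseteq> closure (tile s i)"
    if "q \<in> closure (tile s i)" for q
    using cbox_subset_closure_tile[OF that si] closure_tile(2)[OF that]
    unfolding axis_rect_def rect_with_lower_left_def by blast
  obtain p q where pq: "p \<le> q" "r = cbox p q"
    using r(1) by (auto simp: axis_rect_def rect_with_lower_left_def)
  have "p \<in> r" "q \<in> r" using pq by (auto simp: mem_cbox_iff)
  then have sp: "s i \<le> p" and q: "q \<in> closure (tile s i)"
    using r(2) closure_tile(2) by blast+
  obtain z where z: "z \<in> interior (tile s i)" using int by blast
  obtain w where w: "w \<in> interior (tile s i)" "fst w < fst z" "snd w < snd z"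
    using open_strict_below[OF open_interior z] .
  have "w \<in> tile s i" "z \<in> tile s i" using z w(1) interior_subset by blast+
  then have "s i \<le> w" "s i \<le> z" by (auto simp: mem_tile)
  then have "0 < area (cbox (s i) z)"
    using w by (subst area_cbox) (auto simp: less_eq_prod_def)
  also have "\<dots> \<le> area r"
    using box[of z] max z interior_subset closure_subset by blast
  finally have pos: "0 < (fst q - fst p) * (snd q - snd p)"
    using pq area_cbox by auto
  moreover have "0 \<le> fst q - fst p" "0 \<le> snd q - snd p"
    using pq by (auto simp: less_eq_prod_def)
  ultimately have d: "0 < fst q - fst p" "0 < snd q - snd p"
    by (auto simp: zero_less_mult_iff)
  have "area (cbox (s i) q) \<le> area r" using box[OF q] max by blast
  then have le: "(fst q - fst (s i)) * (snd q - snd (s i))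
      \<le> (fst q - fst p) * (snd q - snd p)"
    using pq sp area_cbox by auto
  have sp': "fst (s i) \<le> fst p" "snd (s i) \<le> snd p" using sp by (auto simp: less_eq_prod_def)
  have "fst (s i) = fst p"
  proof (rule ccontr)
    assume "fst (s i) \<noteq> fst p"
    then have "(fst q - fst p) * (snd q - snd p) < (fst q - fst (s i)) * (snd q - snd p)"
      using sp' d by (intro mult_strict_right_mono) auto
    also have "\<dots> \<le> (fst q - fst (s i)) * (snd q - snd (s i))"
      using sp' d by (intro mult_left_mono) auto
    finally show False using le by simp
  qed
  moreover have "snd (s i) = snd p"
  proof (rule ccontr)
    assume "snd (s i) \<noteq> snd p"
    then have "(fst q - fst p) * (snd q - snd p) < (fst q - fst p) * (snd q - snd (s i))"
      using sp' d by (intro mult_strict_left_mono) auto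
    also have "\<dots> \<le> (fst q - fst (s i)) * (snd q - snd (s i))"
      using sp' d by (intro mult_right_mono) auto
    finally show False using le by simp
  qed
  ultimately have "s i = p" by (simp add: prod_eq_iff)
  then show ?thesis using pq unfolding rect_with_lower_left_def by blast
qed

text \<open>A common interior point \<open>p\<close> has another one, \<open>q\<close>, strictly
  below and to the left. As \<open>s i\<close> is below \<open>q\<close>, it is strictly below
  \<open>p\<close>, which \<open>closure_tile\<close> excludes for the later tile
  \<open>j\<close>.\<close>

lemma interior_disjoint_closure_tiles:
  assumes "R \<subseteq> closure (tile s i)" "R' \<subseteq> closure (tile s j)" "1 \<le> i" "i < j"
  shows "interior_disjoint R R'"
  unfolding interior_disjoint_def
proof (rule ccontr)
  assume "interior R \<inter> interior R' \<noteq> {}"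
  then obtain p where p: "p \<in> interior R \<inter> interior R'" by blast
  obtain q where q: "q \<in> interior R \<inter> interior R'" "fst q < fst p" "snd q < snd p"
    using open_strict_below[OF _ p] by blast
  have "s i \<le> q" using q(1) assms(1) interior_subset closure_tile(2) by blast
  moreover have "p \<in> closure (tile s j)" using p assms(2) interior_subset by blast
  ultimately show False
    using closure_tile(3)[of p s j i] q assms(3,4) by (auto simp: less_eq_prod_def)
qed

subsection \<open>Arms of the tiles\<close>

text \<open>Kept as a set of abscissae rather than a length, so that sums over the tiles above a
  fixed \<open>x\<close> can be integrated over \<open>x\<close>.\<close>

definition base :: "(nat \<Rightarrow> real \<times> real) \<Rightarrow> nat \<Rightarrow> real set" where
  "base s i = {x. (x, snd (s i)) \<in> tile s i}"

text \<open>The minimum is the side of the largest square at \<open>s i\<close> whose upper right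
  corner is below \<open>p\<close>. The supremum need not be attained, since the tile lacks part of
  its upper right boundary.\<close>

definition square_side :: "(nat \<Rightarrow> real \<times> real) \<Rightarrow> nat \<Rightarrow> real" where
  "square_side s i = (SUP p\<in>tile s i. min (fst p - fst (s i)) (snd p - snd (s i)))"

lemma square_side_swap: "square_side (prod.swap \<circ> s) i = square_side s i"
  by (simp add: square_side_def tile_swap image_image min.commute)

lemma base_borel: "base s i \<in> sets borel"
proof -
  have "base s i = (\<lambda>x. (x, snd (s i))) -` tile s i \<inter> space borel"
    by (auto simp: base_def)
  moreover have "(\<lambda>x. (x, snd (s i))) \<in> borel_measurable borel"
    by (intro borel_measurable_continuous_onI continuous_intros)
  ultimately show ?thesis using tile_borel measurable_sets by metis
qed

lemma base_subset: "base s i \<subseteq> cbox 0 1"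
  by (auto simp: base_def mem_tile mem_unit_square)

text \<open>These assumptions are invariant under exchanging the coordinates, so results on
  horizontal arms transfer to vertical ones by interpreting the locale for
  \<open>prod.swap \<circ> s\<close>.\<close>

locale sweep_order =
  fixes s :: "nat \<Rightarrow> real \<times> real" and n :: nat
  assumes inj: "inj_on s {1..n}"
    and unit: "i \<in> {1..n} \<Longrightarrow> s i \<in> unit_square"
    and origin: "\<exists>i\<in>{1..n}. s i = (0, 0)"
    and sweep: "i \<in> {1..n} \<Longrightarrow> j \<in> {1..n} \<Longrightarrow> i < j \<Longrightarrow>
      fst (s j) + snd (s j) \<le> fst (s i) + snd (s i)"
begin

lemma swap: "sweep_order (prod.swap \<circ> s) n"
proof
  show "inj_on (prod.swap \<circ> s) {1..n}" using inj by (intro comp_inj_on inj_swap)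
  obtain i where "i \<in> {1..n}" "s i = (0, 0)" using origin by blast
  then show "\<exists>i\<in>{1..n}. (prod.swap \<circ> s) i = (0, 0)" by (intro bexI[of _ i]) auto
next
  fix i assume "i \<in> {1..n}"
  then show "(prod.swap \<circ> s) i \<in> unit_square" using unit[of i] by (simp add: mem_unit_square)
next
  fix i j assume "i \<in> {1..n}" "j \<in> {1..n}" "i < j"
  then show "fst ((prod.swap \<circ> s) j) + snd ((prod.swap \<circ> s) j)
      \<le> fst ((prod.swap \<circ> s) i) + snd ((prod.swap \<circ> s) i)"
    using sweep[of i j] by (simp add: add.commute)
qed

text \<open>An earlier point has at least the same coordinate sum, so it can be below
  \<open>s i\<close> only by equality, which injectivity rules out even among ties.\<close>

lemma corner_in_tile:
  assumes i: "i \<in> {1..n}"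
  shows "s i \<in> tile s i"
proof -
  have "\<not> s j \<le> s i" if j: "j \<in> {1..<i}" for j
  proof
    assume "s j \<le> s i"
    moreover have "fst (s i) + snd (s i) \<le> fst (s j) + snd (s j)"
      using sweep[of j i] i j by auto
    ultimately have "s j = s i" by (auto simp: less_eq_prod_def prod_eq_iff)
    then have "j = i" using i j by (intro inj_onD[OF inj]) auto
    then show False using j by simp
  qed
  then show ?thesis using unit[OF i] by (simp add: mem_tile)
qed

lemma bdd_above_square:
  "bdd_above ((\<lambda>p. min (fst p - fst (s i)) (snd p - snd (s i))) ` tile s i)"
  by (rule bdd_aboveI[of _ "1 - fst (s i)"]) (auto simp: mem_tile mem_unit_square)

lemma square_side_upper:
  "p \<in> tile s i \<Longrightarrow> min (fst p - fst (s i)) (snd p - snd (s i)) \<le> square_side s i"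
  unfolding square_side_def by (rule cSUP_upper[OF _ bdd_above_square])

lemma square_side_nonneg: "i \<in> {1..n} \<Longrightarrow> 0 \<le> square_side s i"
  using square_side_upper[OF corner_in_tile] by force

lemma square_side_le: "i \<in> {1..n} \<Longrightarrow> fst (s i) + square_side s i \<le> 1"
proof -
  assume i: "i \<in> {1..n}"
  have "square_side s i \<le> 1 - fst (s i)"
    unfolding square_side_def
  proof (rule cSUP_least)
    show "tile s i \<noteq> {}" using corner_in_tile[OF i] by blast
  qed (auto simp: mem_tile mem_unit_square)
  then show ?thesis by simp
qed

text \<open>Strict bounds let some tile point beat \<open>q\<close> in both coordinates although the
  supremum may not be attained.\<close>

lemma half_open_square_in_tile:
  assumes i: "i \<in> {1..n}" and q: "s i \<le> q"
    "fst q < fst (s i) + square_side s i" "snd q < snd (s i) + square_side s i"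
  shows "q \<in> tile s i"
proof -
  have "max (fst q - fst (s i)) (snd q - snd (s i)) < square_side s i" using q by auto
  then obtain p where p: "p \<in> tile s i"
    "max (fst q - fst (s i)) (snd q - snd (s i)) < min (fst p - fst (s i)) (snd p - snd (s i))"
    using corner_in_tile[OF i] unfolding square_side_def
    by (subst (asm) less_cSUP_iff[OF _ bdd_above_square]) auto
  then show ?thesis
    by (intro tile_down_closed[OF p(1) q(1) _ unit[OF i]]) (auto simp: less_eq_prod_def)
qed

text \<open>Were \<open>k\<close> earlier than \<open>m\<close>, tile \<open>m\<close> could not
  contain \<open>(x, snd (s m))\<close>, which dominates \<open>s k\<close>.\<close>

lemma sweep_of_lower_base:
  assumes k: "k \<in> {1..n}" "x \<in> base s k" and m: "m \<in> {1..n}" "x \<in> base s m"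
    and le: "snd (s k) \<le> snd (s m)" and ne: "k \<noteq> m"
  shows "m < k"
proof (rule ccontr)
  assume "\<not> m < k"
  then have "k \<in> {1..<m}" using k ne by auto
  moreover have "s k \<le> (x, snd (s m))"
    using k(2) le by (auto simp: base_def mem_tile less_eq_prod_def)
  ultimately show False using m(2) by (auto simp: base_def mem_tile)
qed

text \<open>The half-open square of side \<open>square_side s k\<close> at \<open>s k\<close> lies in tile \<open>k\<close> and hence has no
  point dominating \<open>s m\<close>. So \<open>s m\<close> lies to the right of the square or above it; in the latter case
  \<open>x + 2 * y = (x + y) + y\<close> still grows by the side, because \<open>x + y\<close> does not decrease.\<close>

lemma square_step:
  assumes k: "k \<in> {1..n}" "x \<in> base s k" and m: "m \<in> {1..n}" "x \<in> base s m"
    and le: "snd (s k) \<le> snd (s m)" and ne: "k \<noteq> m"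
  shows "fst (s k) + 2 * snd (s k) + square_side s k \<le> fst (s m) + 2 * snd (s m)"
proof -
  have mk: "m < k" by (rule sweep_of_lower_base[OF assms])
  then have c: "fst (s k) + snd (s k) \<le> fst (s m) + snd (s m)" using sweep k m by blast
  \<comment> \<open>The join of \<open>s k\<close> and \<open>s m\<close>: the earlier corner
    \<open>s m\<close> bars it from tile \<open>k\<close>, so it lies outside the half-open
    square.\<close>
  define q where "q = (max (fst (s k)) (fst (s m)), snd (s m))"
  have "s m \<le> q" by (simp add: q_def less_eq_prod_def)
  then have "q \<notin> tile s k" using mk m by (auto simp: mem_tile)
  then have "\<not> (fst q < fst (s k) + square_side s k \<and> snd q < snd (s k) + square_side s k)"
    using half_open_square_in_tile[OF k(1), of q] le by (auto simp: q_def less_eq_prod_def)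
  then show ?thesis using c le square_side_nonneg[OF k(1)] by (auto simp: q_def)
qed

text \<open>By \<open>square_step\<close> the intervals \<open>J i\<close> are disjoint; being
  half-open, they may abut. They fit into \<open>{0..3}\<close> because
  \<open>fst (s i) + square_side s i\<close> is at most 1 and \<open>2 * snd (s i)\<close> at most
  2.\<close>

lemma column_sum: "(\<Sum>i\<in>{i\<in>{1..n}. x \<in> base s i}. square_side s i) \<le> 3"
proof -
  define I where "I = {i\<in>{1..n}. x \<in> base s i}"
  define J where "J i = {fst (s i) + 2 * snd (s i) ..< fst (s i) + 2 * snd (s i) + square_side s i}"
    for i
  have J: "measure lborel (J i) = square_side s i" "emeasure lborel (J i) \<noteq> \<infinity>"
    if "i \<in> I" for i
    using square_side_nonneg[of i] that by (auto simp: J_def I_def)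
  have disj: "J k \<inter> J m = {}"
    if "k \<in> I" "m \<in> I" "k \<noteq> m" "snd (s k) \<le> snd (s m)" for k m
    using square_step[of k x m] that by (auto simp: I_def J_def)
  have "disjoint_family_on J I"
    unfolding disjoint_family_on_def using disj
    by (metis Int_commute nle_le)
  then have "(\<Sum>i\<in>I. measure lborel (J i)) = measure lborel (\<Union>i\<in>I. J i)"
    using J(2) by (intro measure_finite_Union[symmetric]) (auto simp: I_def J_def[abs_def])
  also have "\<dots> \<le> measure lborel {0..3::real}"
  proof (rule measure_mono_fmeasurable)
    show "(\<Union>i\<in>I. J i) \<subseteq> {0..3}"
    proof (rule UN_least)
      fix i assume "i \<in> I"
      then have "i \<in> {1..n}" by (simp add: I_def)
      then show "J i \<subseteq> {0..3}"
        using unit[of i] square_side_le[of i] by (auto simp: J_def mem_unit_square)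
    qed
    show "{0..3::real} \<in> fmeasurable lborel" by (simp add: fmeasurable_cbox flip: box_real)
  qed (auto simp: J_def I_def intro!: sets.finite_UN)
  finally show ?thesis using J(1) by (simp add: I_def)
qed

text \<open>Integrate \<open>column_sum\<close> over \<open>x\<close>, with each base length written
  as the integral of its indicator.\<close>

lemma base_sum: "(\<Sum>i = 1..n. measure lborel (base s i) * square_side s i) \<le> 3"
proof -
  have fin: "emeasure lborel (base s i) < \<infinity>" for i
    using emeasure_bounded_finite[of "base s i"] base_subset bounded_subset[OF bounded_cbox]
    by blast
  have int: "integrable lborel (indicator (base s i) :: real \<Rightarrow> real)" for i
    using fin base_borel by (auto simp: integrable_indicator_iff)
  have "(\<Sum>i = 1..n. measure lborel (base s i) * square_side s i)
      = (\<integral>x. (\<Sum>i = 1..n. indicator (base s i) x * square_side s i) \<partial>lborel)"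
    using int by (subst Bochner_Integration.integral_sum) auto
  also have "\<dots> \<le> (\<integral>x. indicator {0..1::real} x * 3 \<partial>lborel)"
  proof (rule integral_mono)
    fix x :: real
    show "(\<Sum>i = 1..n. indicator (base s i) x * square_side s i) \<le> indicator {0..1} x * 3"
    proof (cases "x \<in> {0..1}")
      case True
      have "(\<Sum>i = 1..n. indicator (base s i) x * square_side s i)
          = (\<Sum>i\<in>{i\<in>{1..n}. x \<in> base s i}. square_side s i)"
        by (rule sum.mono_neutral_cong_right) (auto simp: indicator_def)
      then show ?thesis using column_sum[of x] True by simp
    next
      case False
      then have "x \<notin> base s i" for i using base_subset[of s i] by auto
      then show ?thesis using False by simp
    qed
  qed (intro Bochner_Integration.integrable_sum integrable_mult_left int, simp)
  also have "\<dots> = 3" by simp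
  finally show ?thesis .
qed

end

subsection \<open>Area of a tile\<close>

text \<open>For \<open>h = square_side s i\<close> this is the horizontal arm.\<close>

definition strip :: "(nat \<Rightarrow> real \<times> real) \<Rightarrow> nat \<Rightarrow> real \<Rightarrow> (real \<times> real) set" where
  "strip s i h = {p \<in> tile s i. snd p \<le> snd (s i) + h}"

lemma strip_borel: "strip s i h \<in> sets borel"
proof -
  have "strip s i h = tile s i \<inter> {p. snd p \<le> snd (s i) + h}" by (auto simp: strip_def)
  moreover have "closed {p :: real \<times> real. snd p \<le> snd (s i) + h}"
    by (intro closed_Collect_le continuous_intros)
  ultimately show ?thesis using tile_borel by auto
qed

lemma tile_fmeasurable: "tile s i \<in> fmeasurable lborel"
proof (rule fmeasurableI2)
  show "cbox (0, 0) (1, 1) \<in> fmeasurable (lborel :: (real \<times> real) measure)"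
    by (rule fmeasurable_cbox)
  show "tile s i \<subseteq> cbox (0, 0) (1, 1)" by (auto simp: tile_def unit_square_def)
  show "tile s i \<in> sets lborel" using tile_borel by simp
qed

lemma strip_fmeasurable: "strip s i h \<in> fmeasurable lborel"
proof (rule fmeasurableI2[OF tile_fmeasurable])
  show "strip s i h \<subseteq> tile s i" by (auto simp: strip_def)
  show "strip s i h \<in> sets lborel" using strip_borel by simp
qed

text \<open>Each point of the strip projects vertically onto the bottom side, since the tile is
  closed downwards above \<open>s i\<close>.\<close>

lemma area_thin_strip:
  assumes "s i \<in> unit_square" "0 \<le> h"
  shows "area (strip s i h) \<le> measure lborel (base s i) * h"
proof -
  have "strip s i h \<subseteq> base s i \<times> cbox (snd (s i)) (snd (s i) + h)"
  proof
    fix p assume p: "p \<in> strip s i h"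
    have "(fst p, snd (s i)) \<in> tile s i"
      by (rule tile_down_closed[of p])
        (use p assms(1) in \<open>auto simp: strip_def mem_tile less_eq_prod_def\<close>)
    then show "p \<in> base s i \<times> cbox (snd (s i)) (snd (s i) + h)"
      using p by (simp add: strip_def base_def mem_tile less_eq_prod_def mem_Times_iff)
  qed
  then have "area (strip s i h) \<le> area (base s i \<times> cbox (snd (s i)) (snd (s i) + h))"
    using area_Times_cbox(1)[OF base_borel base_subset assms(2)] strip_borel
    by (intro measure_mono_fmeasurable) auto
  then show ?thesis using area_Times_cbox(2)[OF base_borel base_subset assms(2)] by simp
qed

lemma area_strip_step:
  assumes A: "\<And>p. p \<in> tile s i \<Longrightarrow> (fst p - fst (s i)) * (snd p - snd (s i)) \<le> A"
    and "0 < h" "0 \<le> A"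
  shows "area (strip s i (3 / 2 * h)) \<le> area (strip s i h) + A / 2"
proof -
  define B where "B = cbox (fst (s i), snd (s i) + h) (fst (s i) + A / h, snd (s i) + 3 / 2 * h)"
  have sub: "strip s i (3 / 2 * h) \<subseteq> strip s i h \<union> B"
  proof
    fix p assume p: "p \<in> strip s i (3 / 2 * h)"
    show "p \<in> strip s i h \<union> B"
    proof (cases "snd p \<le> snd (s i) + h")
      case True
      then show ?thesis using p by (auto simp: strip_def)
    next
      case False
      have t: "p \<in> tile s i" "fst (s i) \<le> fst p"
        using p by (auto simp: strip_def mem_tile less_eq_prod_def)
      have "(fst p - fst (s i)) * h \<le> (fst p - fst (s i)) * (snd p - snd (s i))"
        using False t by (intro mult_left_mono) auto
      also have "\<dots> \<le> A" by (rule A[OF t(1)])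
      finally have "fst p - fst (s i) \<le> A / h" using assms by (simp add: field_simps)
      then show ?thesis
        using p t False by (auto simp: B_def strip_def mem_cbox_iff less_eq_prod_def)
    qed
  qed
  have "area (strip s i (3 / 2 * h)) \<le> area (strip s i h \<union> B)"
    using sub strip_borel strip_fmeasurable[of s i h]
    by (intro measure_mono_fmeasurable) (auto simp: B_def intro!: fmeasurable.Un)
  also have "\<dots> \<le> area (strip s i h) + area B"
    using strip_borel by (intro measure_Un_le) (auto simp: B_def)
  also have "area B = A / 2"
    using assms unfolding B_def by (subst area_cbox) (auto simp: less_eq_prod_def)
  finally show ?thesis by simp
qed

lemma area_strip:
  assumes A: "\<And>p. p \<in> tile s i \<Longrightarrow> (fst p - fst (s i)) * (snd p - snd (s i)) \<le> A"
    and "0 \<le> h" "0 \<le> A"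
  shows "area (strip s i ((3 / 2) ^ k * h)) \<le> area (strip s i h) + k * (A / 2)"
\<comment> \<open>The growth step divides by \<open>h\<close>; for \<open>h = 0\<close> both strips
  coincide.\<close>
proof (cases "h = 0")
  case False
  show ?thesis
  proof (induction k)
    case (Suc k)
    have "area (strip s i (3 / 2 * ((3 / 2) ^ k * h))) \<le> area (strip s i ((3 / 2) ^ k * h)) + A / 2"
      using False assms by (intro area_strip_step) auto
    then show ?case using Suc by (simp add: field_simps)
  qed simp
qed (use assms in simp)

section \<open>From the area of one tile to the total area\<close>

context sweep_order
begin

lemma area_tile:
  assumes i: "i \<in> {1..n}"
    and A: "\<And>p. p \<in> tile s i \<Longrightarrow> (fst p - fst (s i)) * (snd p - snd (s i)) \<le> A"
  shows "area (tile s i) \<le> k * A + (2 / 3) ^ k *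
    (measure lborel (base s i) * square_side s i
      + measure lborel (base (prod.swap \<circ> s) i) * square_side (prod.swap \<circ> s) i)"
proof -
  interpret swap: sweep_order "prod.swap \<circ> s" n by (rule swap)
  define b where "b = square_side s i"
  have b: "0 \<le> b" using square_side_nonneg[OF i] by (simp add: b_def)
  have A0: "0 \<le> A" using A[OF corner_in_tile[OF i]] by simp
  \<comment> \<open>Stated for arbitrary \<open>t\<close> to serve both \<open>s\<close> and its
    reflection, with the same \<open>b\<close> for both. Growing by 3/2 in each of \<open>k\<close>
    steps from height \<open>(2 / 3) ^ k * b\<close> ends exactly at \<open>b\<close>.\<close>
  have *: "area (strip t i b) \<le> k * (A / 2) + (2 / 3) ^ k * (measure lborel (base t i) * b)"
    if "\<And>p. p \<in> tile t i \<Longrightarrow> (fst p - fst (t i)) * (snd p - snd (t i)) \<le> A"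
      "t i \<in> unit_square" for t
  proof -
    have "(3 / 2) ^ k * ((2 / 3) ^ k * b) = (1::real) ^ k * b"
      by (simp only: mult.assoc[symmetric] power_mult_distrib[symmetric]) simp
    then have "(3 / 2) ^ k * ((2 / 3) ^ k * b) = b" by simp
    moreover have "area (strip t i ((3 / 2) ^ k * ((2 / 3) ^ k * b)))
        \<le> area (strip t i ((2 / 3) ^ k * b)) + k * (A / 2)"
      using b A0 by (intro area_strip that(1)) auto
    moreover have "area (strip t i ((2 / 3) ^ k * b))
        \<le> measure lborel (base t i) * ((2 / 3) ^ k * b)"
      using b by (intro area_thin_strip that(2)) auto
    ultimately show ?thesis by (simp only: mult.left_commute)
  qed
  have sw: "strip (prod.swap \<circ> s) i b = prod.swap ` {p \<in> tile s i. fst p \<le> fst (s i) + b}"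
    by (auto simp: strip_def tile_swap)
  \<comment> \<open>A tile point has a coordinate offset of at most \<open>b\<close>, hence lies in
    one of the two arms.\<close>
  have "area (tile s i) \<le> area (strip s i b \<union> prod.swap ` strip (prod.swap \<circ> s) i b)"
  proof (rule measure_mono_fmeasurable)
    show "tile s i \<subseteq> strip s i b \<union> prod.swap ` strip (prod.swap \<circ> s) i b"
    proof
      fix p assume p: "p \<in> tile s i"
      then show "p \<in> strip s i b \<union> prod.swap ` strip (prod.swap \<circ> s) i b"
        using square_side_upper[OF p] unfolding sw
        by (auto simp: strip_def image_image b_def min_le_iff_disj)
    qed
    have "prod.swap ` strip (prod.swap \<circ> s) i b \<in> sets borel"
      using strip_borel borel_swap_image by blast
    then show "strip s i b \<union> prod.swap ` strip (prod.swap \<circ> s) i b \<in> fmeasurable lborel"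
      using strip_borel unfolding sw
      by (intro fmeasurableI2[OF tile_fmeasurable[of s i]]) (auto simp: image_image strip_def)
  qed (simp add: tile_borel)
  also have "\<dots> \<le> area (strip s i b) + area (prod.swap ` strip (prod.swap \<circ> s) i b)"
    using strip_borel borel_swap_image by (intro measure_Un_le) auto
  also have "\<dots> = area (strip s i b) + area (strip (prod.swap \<circ> s) i b)"
    by (simp add: area_swap_image strip_borel)
  also have "\<dots> \<le> (k * (A / 2) + (2 / 3) ^ k * (measure lborel (base s i) * b))
      + (k * (A / 2) + (2 / 3) ^ k * (measure lborel (base (prod.swap \<circ> s) i) * b))"
    using A unit[OF i] swap.unit[OF i]
    by (intro add_mono *) (auto simp: tile_swap mult.commute)
  finally show ?thesis by (simp add: square_side_swap b_def algebra_simps)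
qed

text \<open>Each point of the square lies in the tile of the first corner it dominates; one exists
  because of the origin.\<close>

lemma one_le_sum_area_tile: "1 \<le> (\<Sum>i = 1..n. area (tile s i))"
proof -
  have "unit_square \<subseteq> (\<Union>i\<in>{1..n}. tile s i)"
  proof
    fix p assume p: "p \<in> unit_square"
    obtain i where "i \<in> {1..n}" "s i = (0, 0)" using origin by blast
    then have ex: "\<exists>i. i \<in> {1..n} \<and> s i \<le> p"
      using p by (auto simp: mem_unit_square less_eq_prod_def intro!: exI[of _ i])
    define l where "l = (LEAST i. i \<in> {1..n} \<and> s i \<le> p)"
    have "l \<in> {1..n} \<and> s l \<le> p" unfolding l_def by (rule LeastI_ex[OF ex])
    moreover have "\<not> s j \<le> p" if "j \<in> {1..<l}" for j
      using not_less_Least[of j "\<lambda>i. i \<in> {1..n} \<and> s i \<le> p"] that calculation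
      by (auto simp: l_def)
    ultimately show "p \<in> (\<Union>i\<in>{1..n}. tile s i)" using p by (auto simp: mem_tile)
  qed
  then have "area unit_square \<le> area (\<Union>i\<in>{1..n}. tile s i)"
    using tile_fmeasurable
    by (intro measure_mono_fmeasurable) (auto simp: unit_square_def intro!: fmeasurable.finite_UN)
  also have "\<dots> \<le> (\<Sum>i = 1..n. area (tile s i))"
    using tile_borel by (intro measure_UNION_le) auto
  finally show ?thesis
    by (simp add: unit_square_def area_cbox less_eq_prod_def)
qed

text \<open>\<open>A\<close> is left abstract so that the areas of either packing can be
  inserted.\<close>

lemma total_area:
  assumes A: "\<And>i p. i \<in> {1..n} \<Longrightarrow> p \<in> tile s i \<Longrightarrow> area (cbox (s i) p) \<le> A i"
  shows "0.09121 \<le> (\<Sum>i = 1..n. A i)"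
proof -
  interpret swap: sweep_order "prod.swap \<circ> s" n by (rule swap)
  have "(fst p - fst (s i)) * (snd p - snd (s i)) \<le> A i"
    if "i \<in> {1..n}" "p \<in> tile s i" for i p
    using A[OF that] that(2) by (simp add: area_cbox mem_tile)
  then have "area (tile s i) \<le> 8 * A i + (2 / 3) ^ 8 *
    (measure lborel (base s i) * square_side s i
      + measure lborel (base (prod.swap \<circ> s) i) * square_side (prod.swap \<circ> s) i)"
    if "i \<in> {1..n}" for i
    \<comment> \<open>With \<open>k\<close> steps the final bound is
      \<open>(1 - 6 * (2 / 3) ^ k) / k\<close>, which is largest at \<open>k = 8\<close>.\<close>
    using area_tile[of i "A i" 8] that by simp
  then have "(\<Sum>i = 1..n. area (tile s i)) \<le> (\<Sum>i = 1..n. 8 * A i + (2 / 3) ^ 8 *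
    (measure lborel (base s i) * square_side s i
      + measure lborel (base (prod.swap \<circ> s) i) * square_side (prod.swap \<circ> s) i))"
    by (rule sum_mono)
  also have "\<dots> = 8 * (\<Sum>i = 1..n. A i) + (2 / 3) ^ 8 *
    ((\<Sum>i = 1..n. measure lborel (base s i) * square_side s i)
      + (\<Sum>i = 1..n. measure lborel (base (prod.swap \<circ> s) i) * square_side (prod.swap \<circ> s) i))"
    by (simp only: sum.distrib sum_distrib_left[symmetric])
  also have "\<dots> \<le> 8 * (\<Sum>i = 1..n. A i) + (2 / 3) ^ 8 * (3 + 3)"
    using base_sum swap.base_sum by (intro add_left_mono mult_left_mono add_mono) auto
  finally show ?thesis using one_le_sum_area_tile by (simp add: power_divide)
qed

end

theorem theorem1:
  fixes S :: "(real \<times> real) set" and n :: nat and s :: "nat \<Rightarrow> real \<times> real"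
  assumes "finite S" and "card S = n"
    and "S \<subseteq> unit_square"
    and "(0, 0) \<in> S"
    and "bij_betw s {1..n} S"
    and "\<And>i j. i \<in> {1..n} \<Longrightarrow> j \<in> {1..n} \<Longrightarrow> i < j \<Longrightarrow>
           fst (s j) + snd (s j) \<le> fst (s i) + snd (s i)"
  shows "(\<forall>r. tile_packing s n r \<longrightarrow>
            (\<forall>i\<in>{1..n}. \<forall>j\<in>{1..n}. i \<noteq> j \<longrightarrow> interior_disjoint (r i) (r j)) \<and>
            (\<forall>i\<in>{1..n}. rect_with_lower_left (s i) (r i)) \<and>
            (\<Sum>i = 1..n. area (r i)) \<ge> 0.09121) \<and>
         (\<forall>r. greedy_packing s n r \<longrightarrow> (\<Sum>i = 1..n. area (r i)) \<ge> 0.09121)"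
proof -
  interpret sweep_order s n
  proof (rule sweep_order.intro)
    show "inj_on s {1..n}" using assms(5) by (rule bij_betw_imp_inj_on)
    have S: "S = s ` {1..n}" using assms(5) by (simp add: bij_betw_def)
    then obtain i where "i \<in> {1..n}" "s i = (0, 0)" using assms(4) by (metis imageE)
    then show "\<exists>i\<in>{1..n}. s i = (0, 0)" by blast
    show "s i \<in> unit_square" if "i \<in> {1..n}" for i
      using assms(3) S that by blast
  qed (rule assms(6))
  have rect: "rect_with_lower_left (s i) (cbox (s i) p)" if "p \<in> tile s i" for i p
    using that unfolding rect_with_lower_left_def mem_tile by blast
  have "(\<forall>i\<in>{1..n}. \<forall>j\<in>{1..n}. i \<noteq> j \<longrightarrow> interior_disjoint (r i) (r j)) \<and>
      (\<forall>i\<in>{1..n}. rect_with_lower_left (s i) (r i)) \<and>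
      (\<Sum>i = 1..n. area (r i)) \<ge> 0.09121" if "tile_packing s n r" for r
  proof (intro conjI ballI impI)
    have r: "axis_rect (r i)" "r i \<subseteq> closure (tile s i)"
      "\<And>R. axis_rect R \<Longrightarrow> R \<subseteq> closure (tile s i) \<Longrightarrow> area R \<le> area (r i)"
      "interior (tile s i) = {} \<Longrightarrow> rect_with_lower_left (s i) (r i)" if "i \<in> {1..n}" for i
      using \<open>tile_packing s n r\<close> that by (auto simp: tile_packing_def)
    show "interior_disjoint (r i) (r j)" if "i \<in> {1..n}" "j \<in> {1..n}" "i \<noteq> j" for i j
    proof (cases "i < j")
      case True
      then show ?thesis
        using that by (intro interior_disjoint_closure_tiles[OF r(2) r(2)]) auto
    next
      case False
      then have "interior_disjoint (r j) (r i)"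
        using that by (intro interior_disjoint_closure_tiles[OF r(2) r(2)]) auto
      then show ?thesis by (auto simp: interior_disjoint_def)
    qed
    show "rect_with_lower_left (s i) (r i)" if "i \<in> {1..n}" for i
      using lower_left_of_max_rect[OF unit[OF that] r(1-3)[OF that]] r(4)[OF that] by blast
    show "(\<Sum>i = 1..n. area (r i)) \<ge> 0.09121"
    proof (rule total_area)
      fix i p assume i: "i \<in> {1..n}" and p: "p \<in> tile s i"
      have "axis_rect (cbox (s i) p)" using rect[OF p] unfolding axis_rect_def by blast
      moreover have "cbox (s i) p \<subseteq> closure (tile s i)"
        using cbox_subset_tile[OF p unit[OF i]] closure_subset by blast
      ultimately show "area (cbox (s i) p) \<le> area (r i)" by (rule r(3)[OF i])
    qed
  qed
  moreover have "(\<Sum>i = 1..n. area (r i)) \<ge> 0.09121" if g: "greedy_packing s n r" for r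
  proof (rule total_area)
    fix i p assume i: "i \<in> {1..n}" and p: "p \<in> tile s i"
    have box: "cbox (s i) p \<subseteq> tile s i" by (rule cbox_subset_tile[OF p unit[OF i]])
    \<comment> \<open>However \<open>r j\<close> was chosen, all its points dominate
      \<open>s j\<close>, and no point of tile \<open>i\<close> does. So the box is a greedy
      candidate.\<close>
    have "interior_disjoint (cbox (s i) p) (r j)" if j: "j \<in> {1..<i}" for j
    proof -
      have "greedy_candidate s r j (r j)" using g i j by (auto simp: greedy_packing_def)
      then have "\<forall>q\<in>r j. s j \<le> q"
        by (auto simp: greedy_candidate_def rect_with_lower_left_def mem_cbox_iff)
      then have "cbox (s i) p \<inter> r j = {}" using box j unfolding tile_def by blast
      then show ?thesis
        using interior_subset unfolding interior_disjoint_def by blast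
    qed
    then have "greedy_candidate s r i (cbox (s i) p)"
      using rect[OF p] box by (auto simp: greedy_candidate_def mem_tile)
    then show "area (cbox (s i) p) \<le> area (r i)" using g i by (auto simp: greedy_packing_def)
  qed
  ultimately show ?thesis by blast
qed

end
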